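(* For every positive integer $n$, \[ \mathrm{SU}(n) = \mathrm{Gr}(\lfloor \tfrac{n}{2} \rfloor, \mathbb{C}^n) \cdot \mathrm{Gr}(\lfloor \tfrac{n}{2} \rfloor,\mathbb{C}^n) \cdot \mathrm{Gr}(\lfloor \tfrac{n}{2} \rfloor, \mathbb{C}^n) \cdot \mathrm{Gr}(\lfloor \tfrac{n}{2} \rfloor,\mathbb{C}^n). \]
   Context: $\mathrm{U}(n)=\{X\in\mathbb{C}^{n\times n}: X^{\mathsf H}X=I_n\}$ and $\mathrm{SU}(n)=\{X\in \mathrm{U}(n):\det X=1\}$. The complex Grassmannian (involution model) is $\mathrm{Gr}(k,\mathbb{C}^n)=\{X\in \mathrm{U}(n): X^2=I_n,\ \operatorname{tr}(X)=2k-n\}$. For sets $S_1,S_2$ of $n\times n$ matrices, $S_1\cdot S_2=\{X_1X_2: X_1\in S_1,\ X_2\in S_2\}$ (matrix products). *)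

theory Defs
  imports "Jordan_Normal_Form.Schur_Decomposition" "HOL-Library.Set_Algebras"
begin

text \<open>On \<^typ>\<open>complex\<close>, \<^const>\<open>conjugate\<close> is complex conjugation, so \<^const>\<open>mat_adjoint\<close> is
  the conjugate transpose. Products of sets of matrices are those of
  \<^theory>\<open>HOL-Library.Set_Algebras\<close>, i.e. all products of their elements.\<close>

definition mat_trace :: "'a :: comm_monoid_add mat \<Rightarrow> 'a" where
  "mat_trace X = (\<Sum>i<dim_row X. X $$ (i, i))"

definition unitary_grp :: "nat \<Rightarrow> complex mat set" where
  "unitary_grp n = {X \<in> carrier_mat n n. mat_adjoint X * X = 1\<^sub>m n}"

definition special_unitary_grp :: "nat \<Rightarrow> complex mat set" where
  "special_unitary_grp n = {X \<in> unitary_grp n. det X = 1}"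

definition grassmannian :: "nat \<Rightarrow> nat \<Rightarrow> complex mat set" where
  "grassmannian k n =
     {X \<in> unitary_grp n. X * X = 1\<^sub>m n \<and> mat_trace X = 2 * of_nat k - of_nat n}"

end

theory Submission
  imports Defs "Jordan_Normal_Form.Spectral_Radius"
begin

text \<open>
  Diagonalize a special unitary matrix unitarily as \<open>diag(d\<^sub>0, \<dots>, d\<^sub>n\<^sub>-\<^sub>1)\<close>, and let
  \<open>Q\<^sub>i = d\<^sub>0 \<cdots> d\<^sub>i\<^sub>-\<^sub>1\<close>, so that \<open>Q\<^sub>0 = Q\<^sub>n = 1\<close>. The diagonal matrix telescopes as
  \<open>diag(Q\<^sub>1, cnj Q\<^sub>1, Q\<^sub>3, cnj Q\<^sub>3, \<dots>) * diag(1, Q\<^sub>2, cnj Q\<^sub>2, Q\<^sub>4, \<dots>)\<close>, and in either factor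
  all entries except possibly one equal to 1 pair up into conjugate pairs. Such a factor is a
  product of two involutions, because \<open>diag(z, cnj z) = [[0, z], [cnj z, 0]] * [[0, 1], [1, 0]]\<close> and
  \<open>1 = (-1) * (-1)\<close>. Conversely, all elements of a Grassmannian have the same determinant \<open>\<plusminus>1\<close>, since
  the trace fixes the multiplicities of the eigenvalues.
\<close>

section \<open>Unitary matrices\<close>

lemma index_mult_mat_sum:
  assumes "A \<in> carrier_mat n m" "B \<in> carrier_mat m l" "i < n" "j < l"
  shows "(A * B) $$ (i, j) = (\<Sum>k<m. A $$ (i, k) * B $$ (k, j))"
  using assms by (auto simp: scalar_prod_def lessThan_atLeast0 intro!: sum.cong)

lemma mat_adjoint_dim [simp]:
  "dim_row (mat_adjoint A) = dim_col A" "dim_col (mat_adjoint A) = dim_row A"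
  by (auto simp: mat_adjoint_def)

lemma mat_adjoint_carrier [simp]: "A \<in> carrier_mat n m \<Longrightarrow> mat_adjoint A \<in> carrier_mat m n"
  by (rule carrier_matI) auto

lemma mat_adjoint_index [simp]:
  "i < dim_col A \<Longrightarrow> j < dim_row A \<Longrightarrow> mat_adjoint A $$ (i, j) = conjugate (A $$ (j, i))"
  by (auto simp: mat_adjoint_def mat_of_rows_def)

lemma mat_adjoint_adjoint [simp]: "mat_adjoint (mat_adjoint A) = A"
  by (rule eq_matI) auto

lemma mat_adjoint_mult:
  assumes "A \<in> carrier_mat n m" "B \<in> carrier_mat m l"
  shows "mat_adjoint (A * B) = mat_adjoint B * mat_adjoint A"
proof (rule eq_matI)
  fix i j
  assume "i < dim_row (mat_adjoint B * mat_adjoint A)" "j < dim_col (mat_adjoint B * mat_adjoint A)"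
  then have ij: "i < l" "j < n" using assms by auto
  have "mat_adjoint (A * B) $$ (i, j) = conjugate ((A * B) $$ (j, i))"
    using ij assms by simp
  also have "\<dots> = (\<Sum>k<m. conjugate (A $$ (j, k)) * conjugate (B $$ (k, i)))"
    using index_mult_mat_sum[OF assms ij(2,1)] by (simp add: sum_conjugate conjugate_dist_mul)
  also have "\<dots> = (mat_adjoint B * mat_adjoint A) $$ (i, j)"
    using ij assms
    by (subst index_mult_mat_sum[OF mat_adjoint_carrier[OF assms(2)] mat_adjoint_carrier[OF assms(1)]])
      (auto intro!: sum.cong simp: mult.commute)
  finally show "mat_adjoint (A * B) $$ (i, j) = (mat_adjoint B * mat_adjoint A) $$ (i, j)" .
qed (use assms in auto)

section \<open>The unitary group: closure properties and orthonormality of columns\<close>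

lemma unitary_grpD:
  assumes "X \<in> unitary_grp n"
  shows "X \<in> carrier_mat n n" "mat_adjoint X * X = 1\<^sub>m n" "X * mat_adjoint X = 1\<^sub>m n"
proof -
  show *: "X \<in> carrier_mat n n" "mat_adjoint X * X = 1\<^sub>m n"
    using assms by (auto simp: unitary_grp_def)
  show "X * mat_adjoint X = 1\<^sub>m n"
    using mat_mult_left_right_inverse[OF mat_adjoint_carrier[OF *(1)] * ] .
qed

lemma unitary_grp_adjoint: "X \<in> unitary_grp n \<Longrightarrow> mat_adjoint X \<in> unitary_grp n"
  using unitary_grpD(1,3)[of X n] by (simp add: unitary_grp_def)

lemma mult_cancel_middle_mat:
  fixes A B C D :: "'a :: semiring_1 mat"
  assumes "A \<in> carrier_mat n n" "B \<in> carrier_mat n n" "C \<in> carrier_mat n n" "D \<in> carrier_mat n n"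
    and "B * C = 1\<^sub>m n"
  shows "(A * B) * (C * D) = A * D"
proof -
  have "(A * B) * (C * D) = A * ((B * C) * D)"
    using assms(1-4) by (simp add: assoc_mult_mat[of _ n n _ n _ n])
  then show ?thesis using assms by simp
qed

lemma unitary_grp_mult:
  assumes "X \<in> unitary_grp n" "Y \<in> unitary_grp n"
  shows "X * Y \<in> unitary_grp n"
proof -
  note X = unitary_grpD[OF assms(1)] and Y = unitary_grpD[OF assms(2)]
  have "mat_adjoint (X * Y) * (X * Y) = (mat_adjoint Y * mat_adjoint X) * (X * Y)"
    using X Y by (simp add: mat_adjoint_mult)
  also have "\<dots> = 1\<^sub>m n"
    using mult_cancel_middle_mat[of "mat_adjoint Y" n "mat_adjoint X" X Y] X Y by auto
  finally show ?thesis using X Y by (simp add: unitary_grp_def)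
qed

lemma unitary_grp_index:
  assumes "X \<in> unitary_grp n" "i < n" "j < n"
  shows "(\<Sum>k<n. cnj (X $$ (k, i)) * X $$ (k, j)) = (if i = j then 1 else 0)"
proof -
  note X = unitary_grpD[OF assms(1)]
  have "(mat_adjoint X * X) $$ (i, j) = (\<Sum>k<n. cnj (X $$ (k, i)) * X $$ (k, j))"
    using assms X(1)
    by (subst index_mult_mat_sum[OF mat_adjoint_carrier[OF X(1)] X(1)]) (auto intro!: sum.cong)
  then show ?thesis using assms X by auto
qed

lemma unitary_grpI_index:
  assumes "X \<in> carrier_mat n n"
    and "\<And>i j. i < n \<Longrightarrow> j < n \<Longrightarrow>
      (\<Sum>k<n. cnj (X $$ (k, i)) * X $$ (k, j)) = (if i = j then 1 else 0)"
  shows "X \<in> unitary_grp n"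
proof -
  have "mat_adjoint X * X = 1\<^sub>m n"
  proof (rule eq_matI)
    fix i j assume "i < dim_row (1\<^sub>m n :: complex mat)" "j < dim_col (1\<^sub>m n :: complex mat)"
    then have ij: "i < n" "j < n" by auto
    have "(mat_adjoint X * X) $$ (i, j) = (\<Sum>k<n. cnj (X $$ (k, i)) * X $$ (k, j))"
      using assms(1) ij
      by (subst index_mult_mat_sum[OF mat_adjoint_carrier[OF assms(1)] assms(1)])
        (auto intro!: sum.cong)
    then show "(mat_adjoint X * X) $$ (i, j) = 1\<^sub>m n $$ (i, j)"
      using assms(2) ij by simp
  qed (use assms(1) in auto)
  then show ?thesis using assms by (simp add: unitary_grp_def)
qed

section \<open>Unitary diagonalization of unitary matrices\<close>

text \<open>Complete \<open>v\<close> to a basis, orthogonalize it by Gram-Schmidt, which keeps the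
  first vector, and normalize; the results are the columns of \<open>W\<close>. Normalization is why
  only a multiple of \<open>v\<close> appears.\<close>

lemma unitary_grp_first_col:
  assumes v: "v \<in> carrier_vec n" "v \<noteq> 0\<^sub>v n"
  obtains W c where "W \<in> unitary_grp n" "col W 0 = c \<cdot>\<^sub>v v"
proof -
  interpret cof_vec_space n "TYPE(complex)" .
  note b = basis_completion[OF v]
  define ws where "ws = gram_schmidt n (basis_completion v)"
  have n: "n > 0" using v by (cases n) auto
  from gram_schmidt_result[OF b(2,4,5) ws_def]
  have ws: "set ws \<subseteq> carrier_vec n" "corthogonal ws" "length ws = n" using b(6) by auto
  obtain vs where "basis_completion v = v # vs" using b(6,7) n by (cases "basis_completion v") auto
  then have "hd ws = v" using gram_schmidt_hd[OF v(1), of vs] by (simp add: ws_def)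
  then have ws0: "ws ! 0 = v" using ws(3) n by (cases ws) auto
  define r where "r i = sqrt (\<Sum>k<n. (cmod (ws ! i $ k))\<^sup>2)" for i
  have dim: "ws ! i \<in> carrier_vec n" if "i < n" for i using ws that by (auto simp: set_conv_nth)
  have ip: "ws ! i \<bullet>c ws ! j = (\<Sum>k<n. ws ! i $ k * cnj (ws ! j $ k))" if "i < n" "j < n" for i j
    using dim[OF that(1)] dim[OF that(2)]
    by (auto simp: scalar_prod_def lessThan_atLeast0 intro!: sum.cong)
  \<comment> \<open>\<open>corthogonal\<close> also says that no vector is orthogonal to itself; the
    case \<open>i = j\<close> of the equivalence yields \<open>r0\<close>, which makes the division
    by \<open>r i\<close> legitimate.\<close>
  have orth: "(\<Sum>k<n. cnj (ws ! i $ k) * ws ! j $ k) = 0 \<longleftrightarrow> i \<noteq> j" if "i < n" "j < n" for i j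
    using corthogonalD[OF ws(2), of j i] ip[OF that(2,1)] that ws(3) by (auto simp: mult.commute)
  have r2: "(\<Sum>k<n. cnj (ws ! i $ k) * ws ! i $ k) = of_real ((r i)\<^sup>2)" for i
    unfolding r_def
    by (subst real_sqrt_pow2)
      (auto intro!: sum_nonneg sum.cong simp: complex_norm_square mult.commute simp del: of_real_power)
  have r0: "r i \<noteq> 0" if "i < n" for i
    using orth[OF that that] r2[of i] by auto
  define W where "W = mat n n (\<lambda>(k, i). ws ! i $ k / of_real (r i))"
  have "W \<in> unitary_grp n"
  proof (rule unitary_grpI_index)
    fix i j assume ij: "i < n" "j < n"
    have "(\<Sum>k<n. cnj (W $$ (k, i)) * W $$ (k, j)) =
      (\<Sum>k<n. cnj (ws ! i $ k) * ws ! j $ k) / (of_real (r i) * of_real (r j))"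
      unfolding sum_divide_distrib W_def using ij by (intro sum.cong) auto
    also have "\<dots> = (if i = j then 1 else 0)"
      using orth[OF ij] r2[of i] r0 ij by (auto simp: power2_eq_square)
    finally show "(\<Sum>k<n. cnj (W $$ (k, i)) * W $$ (k, j)) = (if i = j then 1 else 0)" .
  qed (simp add: W_def)
  moreover have "col W 0 = (1 / of_real (r 0)) \<cdot>\<^sub>v v"
    using n v by (intro eq_vecI) (auto simp: W_def ws0)
  ultimately show ?thesis using that by blast
qed

text \<open>Induction step of the diagonalization. If an eigenvector spans the first column of
  \<open>W\<close>, the first column of \<open>mat_adjoint W * (U * W)\<close> is zero below the
  corner; unitarity then clears the first row as well, so the remaining block is again
  unitary.\<close>

lemma unitary_grp_deflate:
  assumes U: "U \<in> unitary_grp (Suc n)"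
  obtains W e B where "W \<in> unitary_grp (Suc n)" "B \<in> unitary_grp n"
    "U * W = W * four_block_mat (mat 1 1 (\<lambda>_. e)) (0\<^sub>m 1 n) (0\<^sub>m n 1) B"
proof -
  let ?n = "Suc n"
  note Uc = unitary_grpD[OF U]
  from spectrum_non_empty[OF Uc(1)] obtain e v where "eigenvector U v e"
    by (auto simp: spectrum_def eigenvalue_def)
  then have v: "v \<in> carrier_vec ?n" "v \<noteq> 0\<^sub>v ?n" and ev: "U *\<^sub>v v = e \<cdot>\<^sub>v v"
    using Uc(1) by (auto simp: eigenvector_def)
  from unitary_grp_first_col[OF v] obtain W c
    where W: "W \<in> unitary_grp ?n" and Wv: "col W 0 = c \<cdot>\<^sub>v v" by blast
  note Wc = unitary_grpD[OF W]
  define A where "A = mat_adjoint W * (U * W)"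
  have A: "A \<in> unitary_grp ?n"
    unfolding A_def by (intro unitary_grp_mult unitary_grp_adjoint U W)
  note Ac = unitary_grpD[OF A]
  have UW: "U * W \<in> carrier_mat ?n ?n" using Uc Wc by auto
  have "U *\<^sub>v col W 0 = e \<cdot>\<^sub>v col W 0"
    using ev v Uc(1) by (simp add: Wv mult_mat_vec smult_smult_assoc mult.commute)
  then have UW0: "(U * W) $$ (k, 0) = e * W $$ (k, 0)" if "k < ?n" for k
  proof -
    have "(U * W) $$ (k, 0) = (U *\<^sub>v col W 0) $ k" using that Uc(1) Wc(1) by simp
    also have "\<dots> = (e \<cdot>\<^sub>v col W 0) $ k" by (simp only: \<open>U *\<^sub>v col W 0 = e \<cdot>\<^sub>v col W 0\<close>)
    finally show ?thesis using that Wc(1) by simp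
  qed
  have A0: "A $$ (i, 0) = (if i = 0 then e else 0)" if "i < ?n" for i
  proof -
    have "A $$ (i, 0) = (\<Sum>k<?n. cnj (W $$ (k, i)) * (U * W) $$ (k, 0))"
      unfolding A_def using that Wc(1)
      by (subst index_mult_mat_sum[OF mat_adjoint_carrier[OF Wc(1)] UW]) (auto intro!: sum.cong)
    also have "\<dots> = (\<Sum>k<?n. e * (cnj (W $$ (k, i)) * W $$ (k, 0)))"
      by (intro sum.cong) (auto simp: UW0)
    also have "\<dots> = e * (\<Sum>k<?n. cnj (W $$ (k, i)) * W $$ (k, 0))"
      by (simp only: sum_distrib_left)
    finally show ?thesis using unitary_grp_index[OF W that, of 0] by simp
  qed
  \<comment> \<open>The inner product of columns \<open>j\<close> and \<open>0\<close> of
    \<open>A\<close> has a single surviving term, since column \<open>0\<close> is zero below its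
    top entry \<open>e\<close>. The case \<open>j = 0\<close> gives \<open>e \<noteq> 0\<close>, and
    the other cases then clear the top row.\<close>
  have col0: "cnj (A $$ (0, j)) * e = (if j = 0 then 1 else 0)" if "j < ?n" for j
    using unitary_grp_index[OF A that, of 0] by (simp add: sum.lessThan_Suc_shift A0 del: sum.lessThan_Suc)
  have e: "e \<noteq> 0" using col0[of 0] by auto
  have A0': "A $$ (0, j) = 0" if "0 < j" "j < ?n" for j
    using col0[of j] that e by auto
  define B where "B = mat n n (\<lambda>(i, j). A $$ (Suc i, Suc j))"
  have B: "B \<in> unitary_grp n"
  proof (rule unitary_grpI_index)
    fix i j assume ij: "i < n" "j < n"
    have "(\<Sum>k<n. cnj (B $$ (k, i)) * B $$ (k, j)) = (\<Sum>k<?n. cnj (A $$ (k, Suc i)) * A $$ (k, Suc j))"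
      using ij A0' by (simp add: B_def sum.lessThan_Suc_shift del: sum.lessThan_Suc)
    then show "(\<Sum>k<n. cnj (B $$ (k, i)) * B $$ (k, j)) = (if i = j then 1 else 0)"
      using unitary_grp_index[OF A, of "Suc i" "Suc j"] ij by simp
  qed (simp add: B_def)
  have Ab: "A = four_block_mat (mat 1 1 (\<lambda>_. e)) (0\<^sub>m 1 n) (0\<^sub>m n 1) B"
    using Ac(1) A0 A0' by (intro eq_matI) (auto simp: B_def)
  have "W * A = (W * mat_adjoint W) * (U * W)"
    unfolding A_def using Wc(1) UW by (simp add: assoc_mult_mat[of _ ?n ?n _ ?n _ ?n])
  then have "U * W = W * A" by (simp add: Wc(3) left_mult_one_mat[OF UW])
  then show ?thesis using that[OF W B, of e] Ab by simp
qed

theorem unitary_grp_diagonalization: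
  assumes "U \<in> unitary_grp n"
  obtains V d where "V \<in> unitary_grp n" "U = V * mat_diag n d * mat_adjoint V"
proof -
  \<comment> \<open>Moving the adjoint to the other side leaves an equation of plain products, which
    suits block multiplication in the induction.\<close>
  have "\<exists>V d. V \<in> unitary_grp n \<and> U * V = V * mat_diag n d"
    using assms
  proof (induction n arbitrary: U)
    case 0
    \<comment> \<open>All matrices of size zero agree, so \<open>U\<close> itself serves as
      \<open>V\<close>, with any \<open>d\<close>.\<close>
    then have "U * U = U * mat_diag 0 d" for d
      by (intro eq_matI) (auto simp: unitary_grp_def mat_diag_def)
    then show ?case using 0 by blast
  next
    case (Suc n)
    from unitary_grp_deflate[OF Suc.prems] obtain W e B where
      W: "W \<in> unitary_grp (Suc n)" and B: "B \<in> unitary_grp n" and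
      UW: "U * W = W * four_block_mat (mat 1 1 (\<lambda>_. e)) (0\<^sub>m 1 n) (0\<^sub>m n 1) B" by blast
    from Suc.IH[OF B] obtain V d where V: "V \<in> unitary_grp n" and BV: "B * V = V * mat_diag n d"
      by blast
    let ?E = "mat 1 1 (\<lambda>_. e) :: complex mat"
    let ?F = "four_block_mat ?E (0\<^sub>m 1 n) (0\<^sub>m n 1) B"
    \<comment> \<open>\<open>?V\<close> diagonalizes the deflated matrix \<open>?F\<close> and
      leaves its corner alone, so \<open>W * ?V\<close> diagonalizes \<open>U\<close>.\<close>
    let ?V = "four_block_mat (1\<^sub>m 1) (0\<^sub>m 1 n) (0\<^sub>m n 1) V"
    let ?D = "four_block_mat ?E (0\<^sub>m 1 n) (0\<^sub>m n 1) (mat_diag n d)"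
    note Uc = unitary_grpD(1)[OF Suc.prems] and Wc = unitary_grpD(1)[OF W]
      and Bc = unitary_grpD(1)[OF B] and Vc = unitary_grpD(1)[OF V]
    have c: "?V \<in> carrier_mat (Suc n) (Suc n)" "?F \<in> carrier_mat (Suc n) (Suc n)"
      "?D \<in> carrier_mat (Suc n) (Suc n)"
      using Vc Bc four_block_carrier_mat[of _ 1 1 _ n n]
        four_block_carrier_mat[of ?E 1 1 "mat_diag n d" n n] by auto
    have D: "?D = mat_diag (Suc n) (case_nat e d)"
      by (intro eq_matI) (auto simp: mat_diag_def split: nat.splits)
    have "?V \<in> unitary_grp (Suc n)"
    proof (rule unitary_grpI_index)
      fix i j assume "i < Suc n" "j < Suc n"
      then show "(\<Sum>k<Suc n. cnj (?V $$ (k, i)) * ?V $$ (k, j)) = (if i = j then 1 else 0)"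
        using Vc unitary_grp_index[OF V, of "i - 1" "j - 1"]
        by (cases i; cases j) (auto simp: sum.lessThan_Suc_shift simp del: sum.lessThan_Suc)
    qed (use c in auto)
    moreover have "?F * ?V = ?V * ?D"
      using Vc Bc BV by (subst (1 2) mult_four_block_mat[of _ 1 1 _ n _ n _ _ 1 _ n])
        (simp_all add: left_mult_zero_mat[of "mat_diag n d" n n])
    then have "U * (W * ?V) = (W * ?V) * ?D"
      using Uc Wc c UW assoc_mult_mat[OF Uc Wc c(1)] assoc_mult_mat[OF Wc c(2,1)]
        assoc_mult_mat[OF Wc c(1,3)] by simp
    ultimately show ?case using unitary_grp_mult[OF W] D by metis
  qed
  then obtain V d where V: "V \<in> unitary_grp n" and UV: "U * V = V * mat_diag n d" by blast
  note Vc = unitary_grpD[OF V]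
  have "U = U * (V * mat_adjoint V)" using Vc unitary_grpD(1)[OF assms] by simp
  also have "\<dots> = V * mat_diag n d * mat_adjoint V"
    using assoc_mult_mat[OF unitary_grpD(1)[OF assms] Vc(1) mat_adjoint_carrier[OF Vc(1)]] UV by simp
  finally show ?thesis using that V by blast
qed

section \<open>Products, determinants and traces under unitary conjugation\<close>

lemma conj_unitary_mult:
  assumes "V \<in> unitary_grp n" "A \<in> carrier_mat n n" "B \<in> carrier_mat n n"
  shows "(V * A * mat_adjoint V) * (V * B * mat_adjoint V) = V * (A * B) * mat_adjoint V"
proof -
  note V = unitary_grpD[OF assms(1)]
  have "(V * A * mat_adjoint V) * (V * (B * mat_adjoint V)) = V * A * (B * mat_adjoint V)"
    using mult_cancel_middle_mat[of "V * A" n "mat_adjoint V" V "B * mat_adjoint V"] V assms by auto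
  then show ?thesis
    using V(1) assms(2,3) mat_adjoint_carrier[OF V(1)]
    by (simp add: assoc_mult_mat[of _ n n _ n _ n])
qed

lemma conj_unitary_cancel:
  assumes "V \<in> unitary_grp n" "A \<in> carrier_mat n n"
  shows "mat_adjoint V * (V * A * mat_adjoint V) * V = A"
proof -
  note V = unitary_grpD[OF assms(1)]
  have AV: "A * mat_adjoint V \<in> carrier_mat n n" using V assms by auto
  have "mat_adjoint V * (V * A * mat_adjoint V) = (mat_adjoint V * V) * (A * mat_adjoint V)"
    using V(1) assms(2) mat_adjoint_carrier[OF V(1)]
    by (simp add: assoc_mult_mat[of _ n n _ n _ n])
  also have "\<dots> = A * mat_adjoint V" by (simp add: V(2) left_mult_one_mat[OF AV])
  finally show ?thesis
    using V(2) assms(2) assoc_mult_mat[OF assms(2) mat_adjoint_carrier[OF V(1)] V(1)] by simp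
qed

lemma det_conj_unitary:
  assumes "V \<in> unitary_grp n" "A \<in> carrier_mat n n"
  shows "det (V * A * mat_adjoint V) = det A"
proof -
  note V = unitary_grpD[OF assms(1)]
  have "det V * det (mat_adjoint V) = 1"
    using det_mult[OF V(1) mat_adjoint_carrier[OF V(1)]] V(3) by simp
  moreover have "det (V * A * mat_adjoint V) = det A * (det V * det (mat_adjoint V))"
    using V(1) assms(2) mat_adjoint_carrier[OF V(1)] by (simp add: det_mult[of _ n])
  ultimately show ?thesis by simp
qed

lemma mat_trace_mult_comm:
  fixes A B :: "'a :: comm_semiring_0 mat"
  assumes "A \<in> carrier_mat n m" "B \<in> carrier_mat m n"
  shows "mat_trace (A * B) = mat_trace (B * A)"
proof -
  have "mat_trace (A * B) = (\<Sum>i<n. \<Sum>k<m. A $$ (i, k) * B $$ (k, i))"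
    using assms by (simp add: mat_trace_def index_mult_mat_sum del: index_mult_mat(1))
  also have "\<dots> = (\<Sum>k<m. \<Sum>i<n. B $$ (k, i) * A $$ (i, k))"
    by (subst sum.swap) (simp add: mult.commute)
  also have "\<dots> = mat_trace (B * A)"
    using assms by (simp add: mat_trace_def index_mult_mat_sum del: index_mult_mat(1))
  finally show ?thesis .
qed

lemma mat_trace_conj_unitary:
  assumes "V \<in> unitary_grp n" "A \<in> carrier_mat n n"
  shows "mat_trace (V * A * mat_adjoint V) = mat_trace A"
proof -
  note V = unitary_grpD[OF assms(1)]
  have "mat_trace (V * A * mat_adjoint V) = mat_trace (mat_adjoint V * (V * A))"
    using mat_trace_mult_comm[of "V * A" n n "mat_adjoint V"] V assms by auto
  also have "mat_adjoint V * (V * A) = (mat_adjoint V * V) * A"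
    using V(1) assms(2) mat_adjoint_carrier[OF V(1)] by (simp add: assoc_mult_mat[of _ n n _ n _ n])
  finally show ?thesis using V assms by simp
qed

section \<open>Diagonal matrices\<close>

lemma mat_trace_mat_diag: "mat_trace (mat_diag n d) = (\<Sum>i<n. d i)"
  by (auto simp: mat_trace_def mat_diag_def)

lemma det_mat_diag: "det (mat_diag n d) = (\<Prod>i<n. d i)"
proof -
  have "upper_triangular (mat_diag n d)"
    by (auto simp: mat_diag_def)
  then have "det (mat_diag n d) = prod_list (diag_mat (mat_diag n d))"
    by (rule det_upper_triangular[OF _ mat_diag_dim])
  also have "\<dots> = (\<Prod>i<n. d i)"
    by (simp add: prod_list_diag_prod lessThan_atLeast0) (simp add: mat_diag_def)
  finally show ?thesis .
qed

lemma mat_diag_unitary_iff: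
  "mat_diag n d \<in> unitary_grp n \<longleftrightarrow> (\<forall>i<n. cmod (d i) = 1)"
proof -
  have norm1: "cnj z * z = 1 \<longleftrightarrow> cmod z = 1" for z
    using norm_ge_zero[of z] by (auto simp: mult.commute[of "cnj z"] complex_norm_square[symmetric]
      power2_eq_1_iff simp del: of_real_power norm_ge_zero)
  have adj: "mat_adjoint (mat_diag n d) = mat_diag n (\<lambda>i. cnj (d i))"
    by (rule eq_matI) (auto simp: mat_diag_def)
  have "mat_diag n d \<in> unitary_grp n \<longleftrightarrow> mat_diag n (\<lambda>i. cnj (d i) * d i) = 1\<^sub>m n"
    by (simp add: unitary_grp_def adj)
  also have "\<dots> \<longleftrightarrow> (\<forall>i<n. cnj (d i) * d i = 1)"
  proof
    assume *: "mat_diag n (\<lambda>i. cnj (d i) * d i) = 1\<^sub>m n"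
    show "\<forall>i<n. cnj (d i) * d i = 1"
    proof (intro allI impI)
      fix i assume "i < n"
      then show "cnj (d i) * d i = 1"
        using arg_cong[OF *, of "\<lambda>M. M $$ (i, i)"] by (simp add: mat_diag_def)
    qed
  qed (auto intro!: eq_matI simp: mat_diag_def)
  also have "\<dots> \<longleftrightarrow> (\<forall>i<n. cmod (d i) = 1)"
    by (simp add: norm1)
  finally show ?thesis .
qed

section \<open>Grassmannians\<close>

lemma grassmannianD:
  assumes "X \<in> grassmannian k n"
  shows "X \<in> unitary_grp n" "X \<in> carrier_mat n n" "X * X = 1\<^sub>m n"
    "mat_trace X = 2 * of_nat k - of_nat n"
  using assms by (auto simp: grassmannian_def unitary_grp_def)

text \<open>This carries a factorization of the diagonalized matrix back to the original
  one.\<close>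

lemma grassmannian_conj_unitary:
  assumes "X \<in> grassmannian k n" "V \<in> unitary_grp n"
  shows "V * X * mat_adjoint V \<in> grassmannian k n"
  using grassmannianD[OF assms(1)] unitary_grpD[OF assms(2)] assms(2)
    unitary_grp_mult[OF unitary_grp_mult[OF assms(2) grassmannianD(1)[OF assms(1)]]
      unitary_grp_adjoint[OF assms(2)]]
    conj_unitary_mult[OF assms(2), of X X] mat_trace_conj_unitary[OF assms(2), of X]
  by (simp add: grassmannian_def)

text \<open>After diagonalization \<open>X * X = 1\<^sub>m n\<close> forces every eigenvalue to be 1
  or -1, and the trace determines that exactly \<open>k\<close> of them are 1.\<close>

lemma det_grassmannian:
  assumes X: "X \<in> grassmannian k n"
  shows "det X = (-1) ^ (n - k)"
proof -
  note Xg = grassmannianD[OF X]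
  from unitary_grp_diagonalization[OF Xg(1)] obtain V d where
    V: "V \<in> unitary_grp n" and Xd: "X = V * mat_diag n d * mat_adjoint V" by blast
  note Vc = unitary_grpD[OF V]
  define J where "J = {i. i < n \<and> d i = 1}"
  have "V * mat_diag n (\<lambda>i. d i * d i) * mat_adjoint V = 1\<^sub>m n"
    using conj_unitary_mult[OF V, of "mat_diag n d" "mat_diag n d"] Xg(3) by (simp add: Xd)
  then have "mat_diag n (\<lambda>i. d i * d i) = mat_adjoint V * 1\<^sub>m n * V"
    using conj_unitary_cancel[OF V, of "mat_diag n (\<lambda>i. d i * d i)"] by simp
  also have "\<dots> = 1\<^sub>m n" using Vc mat_adjoint_carrier[OF Vc(1)] by simp
  finally have dd: "mat_diag n (\<lambda>i. d i * d i) = 1\<^sub>m n" .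
  have "d i * d i = 1" if "i < n" for i
    using arg_cong[OF dd, of "\<lambda>M. M $$ (i, i)"] that by (simp add: mat_diag_def)
  then have d: "d i = (if i \<in> J then 1 else - 1)" if "i < n" for i
    using that by (auto simp: J_def square_eq_1_iff)
  have J: "J \<subseteq> {..<n}" "finite J" by (auto simp: J_def)
  have "mat_trace X = (\<Sum>i<n. d i)"
    by (simp add: Xd mat_trace_conj_unitary[OF V] mat_trace_mat_diag)
  \<comment> \<open>Each sign is written as twice an indicator minus one, so that the sum counts
    \<open>J\<close>.\<close>
  also have "\<dots> = (\<Sum>i<n. 2 * of_bool (i \<in> J) - 1)"
    by (intro sum.cong) (auto simp: d)
  also have "\<dots> = 2 * of_nat (card J) - of_nat n"
    using J by (simp add: sum_subtractf sum_distrib_left[symmetric] Int_absorb2 of_bool_def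
        sum.If_cases Int_def[symmetric] Int_commute)
  finally have "(of_nat k :: complex) = of_nat (card J)" using Xg(4) by simp
  \<comment> \<open>As \<open>J\<close> lies in \<open>{..<n}\<close>, this gives
    \<open>k \<le> n\<close>, so \<open>n - k\<close> is a true difference.\<close>
  then have k: "k = card J" by simp
  have "det X = (\<Prod>i<n. d i)"
    by (simp add: Xd det_conj_unitary[OF V] det_mat_diag)
  also have "\<dots> = (\<Prod>i<n. if i \<in> J then 1 else - 1)"
    by (intro prod.cong) (auto simp: d)
  also have "\<dots> = (\<Prod>i\<in>{..<n} - J. - 1)"
    by (simp add: prod.If_cases Diff_eq)
  also have "\<dots> = (- 1) ^ (n - k)"
    using J by (simp add: k card_Diff_subset)
  finally show ?thesis .
qed

section \<open>Factorization of diagonal matrices\<close>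

text \<open>A monomial matrix. For an involution \<open>s\<close>, each 2-cycle gives an
  antidiagonal 2 by 2 block and each fixed point a single diagonal entry.\<close>

definition twisted_perm_mat :: "nat \<Rightarrow> (nat \<Rightarrow> nat) \<Rightarrow> (nat \<Rightarrow> complex) \<Rightarrow> complex mat" where
  "twisted_perm_mat n s z = mat n n (\<lambda>(i, j). if j = s i then z i else 0)"

lemma twisted_perm_mat_mult:
  assumes "\<And>i. i < n \<Longrightarrow> s i < n" "\<And>i. i < n \<Longrightarrow> s (s i) = i"
  shows "twisted_perm_mat n s z * twisted_perm_mat n s w = mat_diag n (\<lambda>i. z i * w (s i))"
proof (rule eq_matI)
  fix i j assume "i < dim_row (mat_diag n (\<lambda>i. z i * w (s i)))" "j < dim_col (mat_diag n (\<lambda>i. z i * w (s i)))"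
  then have ij: "i < n" "j < n" by (auto simp: mat_diag_def)
  have "(twisted_perm_mat n s z * twisted_perm_mat n s w) $$ (i, j) =
    (\<Sum>k<n. (if k = s i then z i else 0) * (if j = s k then w k else 0))"
    using ij by (subst index_mult_mat_sum[of _ n n _ n]) (auto simp: twisted_perm_mat_def)
  also have "\<dots> = (\<Sum>k<n. if k = s i then z i * (if j = i then w k else 0) else 0)"
    using ij assms by (intro sum.cong) auto
  also have "\<dots> = (if i = j then z i * w (s i) else 0)"
    using ij assms(1)[of i] by auto
  finally show "(twisted_perm_mat n s z * twisted_perm_mat n s w) $$ (i, j) =
    mat_diag n (\<lambda>i. z i * w (s i)) $$ (i, j)"
    using ij by (auto simp: mat_diag_def)
qed (auto simp: mat_diag_def twisted_perm_mat_def)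

text \<open>The symmetry of \<open>z\<close> along \<open>s\<close> makes the matrix Hermitian, and
  it squares to the identity; hence it is unitary. Only fixed points of \<open>s\<close> reach the
  diagonal, each with entry -1, so the trace is \<open>- (n mod 2)\<close>, the value required for
  \<open>n div 2\<close>.\<close>

lemma twisted_perm_mat_grassmannian:
  assumes s: "\<And>i. i < n \<Longrightarrow> s i < n" "\<And>i. i < n \<Longrightarrow> s (s i) = i"
    and fp: "card {i. i < n \<and> s i = i} = n mod 2"
    and z: "\<And>i. i < n \<Longrightarrow> cmod (z i) = 1" "\<And>i. i < n \<Longrightarrow> z (s i) = cnj (z i)"
      "\<And>i. i < n \<Longrightarrow> s i = i \<Longrightarrow> z i = - 1"
  shows "twisted_perm_mat n s z \<in> grassmannian (n div 2) n"
proof -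
  let ?X = "twisted_perm_mat n s z"
  have zz: "z i * cnj (z i) = 1" if "i < n" for i
    using z(1)[OF that] by (simp add: complex_norm_square[symmetric])
  have carr: "?X \<in> carrier_mat n n" by (simp add: twisted_perm_mat_def)
  have sq: "?X * ?X = 1\<^sub>m n"
    by (subst twisted_perm_mat_mult[OF s]) (auto intro!: eq_matI simp: mat_diag_def z(2) zz)
  have "mat_adjoint ?X = ?X"
  proof (rule eq_matI)
    fix i j assume "i < dim_row ?X" "j < dim_col ?X"
    then have ij: "i < n" "j < n" by (auto simp: twisted_perm_mat_def)
    have "i = s j \<longleftrightarrow> j = s i" using s ij by auto
    then show "mat_adjoint ?X $$ (i, j) = ?X $$ (i, j)"
      using ij z(2)[of i] by (auto simp: twisted_perm_mat_def)
  qed (auto simp: twisted_perm_mat_def)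
  then have uni: "?X \<in> unitary_grp n" using carr sq by (simp add: unitary_grp_def)
  have "mat_trace ?X = (\<Sum>i<n. if s i = i then - 1 else 0)"
    by (auto simp: mat_trace_def twisted_perm_mat_def z(3) intro!: sum.cong)
  also have "\<dots> = (\<Sum>i\<in>{i. i < n \<and> s i = i}. - 1)"
    by (rule sum.mono_neutral_cong_right) auto
  also have "\<dots> = - of_nat (n mod 2)" by (simp add: fp)
  also have "\<dots> = 2 * of_nat (n div 2) - of_nat n"
    using arg_cong[OF mult_div_mod_eq[of 2 n], of "of_nat :: nat \<Rightarrow> complex"]
    unfolding of_nat_add of_nat_mult by (simp add: algebra_simps del: mult_div_mod_eq)
  finally show ?thesis using uni sq by (simp add: grassmannian_def)
qed

text \<open>On a 2-cycle, an antidiagonal block with entries \<open>f i\<close> and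
  \<open>cnj (f i)\<close> times the plain swap gives the two diagonal entries. On a fixed point
  both factors must carry -1 to have the right trace, so their product is 1; this is why
  \<open>f\<close> has to be 1 there.\<close>

lemma mat_diag_paired_grassmannian:
  assumes s: "\<And>i. i < n \<Longrightarrow> s i < n" "\<And>i. i < n \<Longrightarrow> s (s i) = i"
    and fp: "card {i. i < n \<and> s i = i} = n mod 2"
    and f: "\<And>i. i < n \<Longrightarrow> cmod (f i) = 1" "\<And>i. i < n \<Longrightarrow> f (s i) = cnj (f i)"
      "\<And>i. i < n \<Longrightarrow> s i = i \<Longrightarrow> f i = 1"
  obtains X Y where "X \<in> grassmannian (n div 2) n" "Y \<in> grassmannian (n div 2) n"
    "mat_diag n f = X * Y"
proof -
  define z where "z i = (if s i = i then - 1 else f i)" for i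
  define w where "w i = (if s i = i then - 1 else 1 :: complex)" for i
  \<comment> \<open>The branches of \<open>z\<close> and \<open>w\<close> thus agree at
    \<open>i\<close> and \<open>s i\<close>, as the symmetry condition demands.\<close>
  have "s (s i) = s i \<longleftrightarrow> s i = i" if "i < n" for i using s(2)[OF that] by auto
  note zw = z_def w_def this s f
  have "twisted_perm_mat n s z \<in> grassmannian (n div 2) n"
    "twisted_perm_mat n s w \<in> grassmannian (n div 2) n"
    by (rule twisted_perm_mat_grassmannian[of n s, OF s fp]; simp add: zw)+
  moreover have "mat_diag n f = twisted_perm_mat n s z * twisted_perm_mat n s w"
    by (subst twisted_perm_mat_mult[OF s]) (auto intro!: eq_matI simp: mat_diag_def zw)
  ultimately show ?thesis using that by blast
qed

text \<open>Since \<open>d i = Q (Suc i) * cnj (Q i)\<close>, assigning the odd-indexed partial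
  products to \<open>f\<close> and the even-indexed ones to \<open>g\<close> puts each
  \<open>Q k\<close> with \<open>0 < k < n\<close> beside its conjugate in one factor. The ends
  \<open>Q 0\<close> and \<open>Q n\<close> are 1 and fit any parity of \<open>n\<close>.\<close>

lemma mat_diag_grassmannian_factorization:
  assumes d: "\<And>i. i < n \<Longrightarrow> cmod (d i) = 1" "(\<Prod>i<n. d i) = 1" and n: "n > 0"
  obtains A B C D where
    "A \<in> grassmannian (n div 2) n" "B \<in> grassmannian (n div 2) n"
    "C \<in> grassmannian (n div 2) n" "D \<in> grassmannian (n div 2) n"
    "mat_diag n d = (A * B) * (C * D)"
proof -
  define Q where "Q i = (\<Prod>j<i. d j)" for i
  have Q: "cmod (Q i) = 1" if "i \<le> n" for i
    using that d(1) by (auto simp: Q_def prod_norm[symmetric] intro!: prod.neutral)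
  have Q0: "Q 0 = 1" and Qn: "Q n = 1" using d(2) by (auto simp: Q_def)
  define f where "f i = (if even i then Q (Suc i) else cnj (Q i))" for i
  define g where "g i = (if odd i then Q (Suc i) else cnj (Q i))" for i
  have fg: "f i * g i = d i" if "i < n" for i
  proof -
    have "Q i * cnj (Q i) = 1" using Q[of i] that by (simp add: complex_norm_square[symmetric])
    moreover have "f i * g i = (Q i * cnj (Q i)) * d i"
      by (simp add: f_def g_def Q_def mult_ac)
    ultimately show ?thesis by simp
  qed
  \<comment> \<open>\<open>s\<close> swaps \<open>2 * k\<close> and \<open>2 * k + 1\<close>; for
    odd \<open>n\<close> the last index has no partner and stays fixed.\<close>
  define s where "s i = (if odd i then i - 1 else if Suc i < n then Suc i else i)" for i
  \<comment> \<open>\<open>t\<close> swaps \<open>2 * k + 1\<close> and \<open>2 * k + 2\<close>.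
    For even \<open>n\<close> the two leftover ends \<open>0\<close> and \<open>n - 1\<close> are
    swapped; for odd \<open>n\<close> the index \<open>0\<close> is fixed because
    \<open>0 - 1 = 0\<close> on naturals.\<close>
  define t where "t i = (if even n \<and> i = 0 then n - 1 else if even n \<and> Suc i = n then 0
    else if odd i then Suc i else i - 1)" for i
  have s: "s i < n" "s (s i) = i" if "i < n" for i
    using that by (auto simp: s_def)
  have t: "t i < n" if "i < n" for i
  proof -
    \<comment> \<open>Only an odd last index could be sent out of range; it occurs just for even
      \<open>n\<close>, where \<open>t\<close> sends it to \<open>0\<close>.\<close>
    have "Suc i = n \<Longrightarrow> odd i \<longleftrightarrow> even n" by auto
    then show ?thesis using that n by (cases "Suc i = n") (auto simp: t_def)
  qed
  have tt: "t (t i) = i" if "i < n" for i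
    using that n by (cases i) (auto simp: t_def)
  have s_fix: "s i = i \<longleftrightarrow> even i \<and> Suc i = n" if "i < n" for i
    using that by (auto simp: s_def elim: oddE)
  have "{i. i < n \<and> s i = i} = (if odd n then {n - 1} else {})"
  proof (rule Set.set_eqI)
    fix i
    have "i < n \<and> even i \<and> Suc i = n \<longleftrightarrow> odd n \<and> i = n - 1" using n by presburger
    then show "i \<in> {i. i < n \<and> s i = i} \<longleftrightarrow> i \<in> (if odd n then {n - 1} else {})"
      using s_fix[of i] by auto
  qed
  then have sfp: "card {i. i < n \<and> s i = i} = n mod 2" by (simp add: odd_iff_mod_2_eq_one)
  have t_fix: "t i = i \<longleftrightarrow> odd n \<and> i = 0" if "i < n" for i
    using that by (cases i) (auto simp: t_def)
  have "{i. i < n \<and> t i = i} = (if odd n then {0} else {})"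
    using n t_fix by auto
  then have tfp: "card {i. i < n \<and> t i = i} = n mod 2" by (simp add: odd_iff_mod_2_eq_one)
  obtain A B where AB: "A \<in> grassmannian (n div 2) n" "B \<in> grassmannian (n div 2) n"
    "mat_diag n f = A * B"
  proof (rule mat_diag_paired_grassmannian[OF s sfp])
    show "cmod (f i) = 1" if "i < n" for i using Q[of i] Q[of "Suc i"] that by (simp add: f_def)
    show "f (s i) = cnj (f i)" if "i < n" for i
    proof (cases "odd i \<or> Suc i < n")
      \<comment> \<open>This is the unpaired last index, where \<open>f i = Q n = 1\<close> is its
        own conjugate.\<close>
      case False
      then have "Suc i = n" using that by auto
      then show ?thesis using False Qn by (simp add: f_def s_def)
    qed (auto simp: f_def s_def)
    show "f i = 1" if "i < n" "s i = i" for i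
      using s_fix[OF that(1)] that(2) Qn by (simp add: f_def)
  qed
  obtain C D where CD: "C \<in> grassmannian (n div 2) n" "D \<in> grassmannian (n div 2) n"
    "mat_diag n g = C * D"
  proof (rule mat_diag_paired_grassmannian[OF t tt tfp])
    show "cmod (g i) = 1" if "i < n" for i using Q[of i] Q[of "Suc i"] that by (simp add: g_def)
    \<comment> \<open>For even \<open>n\<close> the pair of ends carries \<open>cnj (Q 0)\<close>
      and \<open>Q n\<close>, both equal to 1.\<close>
    show "g (t i) = cnj (g i)" if "i < n" for i
      using that Q0 Qn by (cases i) (auto simp: g_def t_def)
    show "g i = 1" if "i < n" "t i = i" for i
      using t_fix[OF that(1)] that(2) Q0 by (simp add: g_def)
  qed
  have "mat_diag n d = mat_diag n f * mat_diag n g"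
    by (simp add: fg) (auto intro!: eq_matI simp: mat_diag_def fg)
  then show ?thesis using that AB CD by metis
qed

section \<open>Special unitary matrices as products of four involutions\<close>

theorem mainTheorem2:
  fixes n :: nat
  assumes "n > 0"
  shows "special_unitary_grp n =
    grassmannian (n div 2) n * grassmannian (n div 2) n *
    grassmannian (n div 2) n * grassmannian (n div 2) n"
proof (intro equalityI subsetI)
  let ?G = "grassmannian (n div 2) n"
  fix U assume "U \<in> special_unitary_grp n"
  then have U: "U \<in> unitary_grp n" "det U = 1" by (auto simp: special_unitary_grp_def)
  from unitary_grp_diagonalization[OF U(1)] obtain V d where
    V: "V \<in> unitary_grp n" and Ud: "U = V * mat_diag n d * mat_adjoint V" by blast
  have prod: "(\<Prod>i<n. d i) = 1"
    using U(2) by (simp add: Ud det_conj_unitary[OF V] det_mat_diag)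
  \<comment> \<open>The diagonal form is itself unitary, so its entries have modulus 1.\<close>
  have "mat_adjoint V * U * V \<in> unitary_grp n"
    by (intro unitary_grp_mult unitary_grp_adjoint U V)
  then have "mat_diag n d \<in> unitary_grp n"
    by (simp add: Ud conj_unitary_cancel[OF V])
  then have "\<And>i. i < n \<Longrightarrow> cmod (d i) = 1" by (simp add: mat_diag_unitary_iff)
  from mat_diag_grassmannian_factorization[OF this prod assms] obtain A B C D where
    G: "A \<in> ?G" "B \<in> ?G" "C \<in> ?G" "D \<in> ?G" and dd: "mat_diag n d = (A * B) * (C * D)"
    by metis
  note c = G[THEN grassmannianD(2)]
  \<comment> \<open>Conjugation by \<open>V\<close> is multiplicative and preserves the
    Grassmannian, so it may be applied to the four factors one by one.\<close>
  define K where "K M = V * M * mat_adjoint V" for M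
  have K: "K (M * N) = K M * K N" if "M \<in> carrier_mat n n" "N \<in> carrier_mat n n" for M N
    using conj_unitary_mult[OF V that] by (simp add: K_def)
  have "U = K (A * B * C * D)"
    using c by (simp add: Ud K_def dd assoc_mult_mat[of _ n n _ n _ n])
  also have "\<dots> = K A * K B * K C * K D"
    by (simp only: K[OF mult_carrier_mat[OF mult_carrier_mat[OF c(1,2)] c(3)] c(4)]
        K[OF mult_carrier_mat[OF c(1,2)] c(3)] K[OF c(1,2)])
  finally show "U \<in> ?G * ?G * ?G * ?G"
    using G[THEN grassmannian_conj_unitary, OF V] by (auto simp: K_def intro!: set_times_intro)
next
  let ?G = "grassmannian (n div 2) n"
  fix U assume "U \<in> ?G * ?G * ?G * ?G"
  then obtain A B C D where G: "A \<in> ?G" "B \<in> ?G" "C \<in> ?G" "D \<in> ?G" and U: "U = A * B * C * D"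
    by (auto elim!: set_times_elim)
  note c = G[THEN grassmannianD(2)]
  \<comment> \<open>The four factors share one determinant, a sign, whose fourth power is 1.\<close>
  have "det U = ((- 1) ^ (n - n div 2)) ^ 4"
    using c G[THEN det_grassmannian] by (simp add: U det_mult[of _ n] power4_eq_xxxx)
  also have "\<dots> = 1" by (simp add: power_mult[symmetric])
  finally show "U \<in> special_unitary_grp n"
    using G[THEN grassmannianD(1)] by (simp add: special_unitary_grp_def U unitary_grp_mult)
qed

end
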